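(* Let $(Y,*,\circ)$ and $(K,*,\circ)$ be digroups, let $\psi_*\colon(Y,* )\to\mathrm{Aut}(K,* )$ and $\psi_\circ\colon(Y,\circ)\to\mathrm{Aut}(K,\circ)$ be two group actions, and let $\xi\colon(Y,1)\to(S_K,\mathrm{Id}_K)$, $y\mapsto\xi_y$, be any mapping of pointed sets (i.e. any mapping with $\xi_1=\mathrm{Id}_K$), where $S_K$ is the symmetric group of $K$. On $Y\times K$ consider the semidirect product law $$(y,k)\ltimes_{\psi_*}(y',k')=(y*y',\,k*\psi_{*y}(k')),$$ and the law $\circ_\xi$ obtained by transferring the semidirect product law $(y,k)\ltimes_{\psi_\circ}(y',k')=(y\circ y',\,k\circ\psi_{\circ y}(k'))$ along the permutation $\Xi\colon Y\times K\to Y\times K$, $(y,k)\mapsto(y,\xi_y(k))$, namely $$(y,k)\circ_\xi(y',k')=\bigl(y\circ y',\ \xi_{y\circ y'}(\xi_y^{-1}(k)\circ\psi_{\circ y}(\xi_{y'}^{-1}(k')))\bigr).$$ Let $p_Y(y,k)=y$ and $\iota_Y(y)=(y,1)$. Then $(p_Y,\iota_Y)\colon(Y\times K,\ltimes_{\psi_*},\circ_\xi)\rightleftarrows(Y,*,\circ)$ is a split epimorphism in the category of digroups whose kernel is $(K,*,\circ)$, whose skewing index is $\xi$, and such that $\phi_{\ltimes_{\psi_*}}=\psi_*$ and $\phi_{\circ_\xi}=\psi_\circ$, where $\phi_{\ltimes_{\psi_*}}$ and $\phi_{\circ_\xi}$ are the canonical group actions associated with $(p_Y,\iota_Y)$ for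 the laws $\ltimes_{\psi_*}$ and $\circ_\xi$.
   Context: A digroup $(X,*,\circ)$ is a set with two group structures having the same unit $1$; morphisms are maps that are homomorphisms for both laws. $x^{-*}$ and $x^{-\circ}$ denote the inverses for $*$ and $\circ$. A split epimorphism $(f,s)\colon X\rightleftarrows Y$ consists of morphisms $f\colon X\to Y$, $s\colon Y\to X$ with $fs=\mathrm{Id}_Y$; $K$ denotes the kernel of $f$. For a split epimorphism of digroups $(f,s)\colon(X,*,\circ)\rightleftarrows(Y,*,\circ)$ with kernel $K$, the canonical group actions are $\phi_{*y}(k)=s(y)*k*s(y)^{-*}$ and $\phi_{\circ y}(k)=s(y)\circ k\circ s(y)^{-\circ}$ (in the claim, the subscript of $\phi$ indicates the law of the domain that is used). The skewing index of $(f,s)$ is the mapping $\xi^{(f,s)}\colon(Y,1)\to(S_K,\mathrm{Id}_K)$ given by $\xi^{(f,s)}_y(k)=(k\circ s(y))*s(y)^{-*}$.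
   Formalization: Each permutation ξ_y is additionally required to fix the unit 1 of K; this is necessary because every skewing index satisfies ξ_y(1)=1, so the claim fails e.g. for Y=K=Z/2 with trivial actions and ξ_y the swap for y≠1. *)

theory Defs
  imports "HOL-Algebra.Coset" "HOL-Algebra.Bij"
begin

record 'a digroup = "'a partial_object" +
  star  :: "'a \<Rightarrow> 'a \<Rightarrow> 'a"
  circ  :: "'a \<Rightarrow> 'a \<Rightarrow> 'a"
  dunit :: 'a

definition star_group :: "'a digroup \<Rightarrow> 'a monoid" where
  "star_group X = \<lparr>carrier = carrier X, mult = star X, one = dunit X\<rparr>"

definition circ_group :: "'a digroup \<Rightarrow> 'a monoid" where
  "circ_group X = \<lparr>carrier = carrier X, mult = circ X, one = dunit X\<rparr>"

definition is_digroup :: "'a digroup \<Rightarrow> bool" where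
  "is_digroup X \<longleftrightarrow> group (star_group X) \<and> group (circ_group X)"

definition digroup_hom :: "'a digroup \<Rightarrow> 'b digroup \<Rightarrow> ('a \<Rightarrow> 'b) set" where
  "digroup_hom X Y = hom (star_group X) (star_group Y) \<inter> hom (circ_group X) (circ_group Y)"

definition digroup_iso :: "'a digroup \<Rightarrow> 'b digroup \<Rightarrow> ('a \<Rightarrow> 'b) set" where
  "digroup_iso X Y = {h \<in> digroup_hom X Y. bij_betw h (carrier X) (carrier Y)}"

definition split_epi ::
  "'a digroup \<Rightarrow> 'b digroup \<Rightarrow> ('a \<Rightarrow> 'b) \<Rightarrow> ('b \<Rightarrow> 'a) \<Rightarrow> bool" where
  "split_epi X Y f s \<longleftrightarrow> is_digroup X \<and> is_digroup Y \<and>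
     f \<in> digroup_hom X Y \<and> s \<in> digroup_hom Y X \<and> (\<forall>y\<in>carrier Y. f (s y) = y)"

text \<open>The two group kernels of a morphism of digroups coincide as sets, because both laws
  have the same unit; this set with the restricted laws is the kernel.\<close>

definition digroup_kernel :: "'a digroup \<Rightarrow> 'b digroup \<Rightarrow> ('a \<Rightarrow> 'b) \<Rightarrow> 'a digroup" where
  "digroup_kernel X Y f = X\<lparr>carrier := kernel (star_group X) (star_group Y) f\<rparr>"

text \<open>Conjugation action for one of the two laws: \<open>G\<close> is \<open>star_group X\<close> or \<open>circ_group X\<close>,
  and \<open>N\<close> is the underlying set of the kernel.\<close>

definition canonical_action ::
  "'a monoid \<Rightarrow> 'a set \<Rightarrow> ('b \<Rightarrow> 'a) \<Rightarrow> 'b \<Rightarrow> 'a \<Rightarrow> 'a" where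
  "canonical_action G N s y = (\<lambda>k\<in>N. s y \<otimes>\<^bsub>G\<^esub> k \<otimes>\<^bsub>G\<^esub> inv\<^bsub>G\<^esub> (s y))"

definition skewing_index ::
  "'a digroup \<Rightarrow> 'b digroup \<Rightarrow> ('a \<Rightarrow> 'b) \<Rightarrow> ('b \<Rightarrow> 'a) \<Rightarrow> 'b \<Rightarrow> 'a \<Rightarrow> 'a" where
  "skewing_index X Y f s y =
     (\<lambda>k\<in>carrier (digroup_kernel X Y f). star X (circ X k (s y)) (inv\<^bsub>star_group X\<^esub> (s y)))"

text \<open>The symmetric group \<open>S\<^sub>K\<close> consists here of the permutations of the \<^emph>\<open>pointed\<close> set \<open>(K,1)\<close>.
  This is where skewing indexes take their values (see \<open>skewing_index_pointed\<close> below). A map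
  with values in all permutations of the underlying set need not be a skewing index.\<close>

definition pointed_perms :: "'a digroup \<Rightarrow> ('a \<Rightarrow> 'a) set" where
  "pointed_perms K = {\<sigma> \<in> Bij (carrier K). \<sigma> (dunit K) = dunit K}"

definition semidirect ::
  "'y monoid \<Rightarrow> 'k monoid \<Rightarrow> ('y \<Rightarrow> 'k \<Rightarrow> 'k) \<Rightarrow> ('y \<times> 'k) monoid" where
  "semidirect G H \<psi> =
     \<lparr>carrier = carrier G \<times> carrier H,
      mult = (\<lambda>(y, k) (y', k'). (y \<otimes>\<^bsub>G\<^esub> y', k \<otimes>\<^bsub>H\<^esub> \<psi> y k')),
      one = (\<one>\<^bsub>G\<^esub>, \<one>\<^bsub>H\<^esub>)\<rparr>"

definition circ_xi ::
  "'y digroup \<Rightarrow> 'k digroup \<Rightarrow> ('y \<Rightarrow> 'k \<Rightarrow> 'k) \<Rightarrow> ('y \<Rightarrow> 'k \<Rightarrow> 'k)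
     \<Rightarrow> 'y \<times> 'k \<Rightarrow> 'y \<times> 'k \<Rightarrow> 'y \<times> 'k" where
  "circ_xi Y K \<psi> \<xi> = (\<lambda>(y, k) (y', k').
     (circ Y y y',
      \<xi> (circ Y y y') (circ K (inv_into (carrier K) (\<xi> y) k)
                              (\<psi> y (inv_into (carrier K) (\<xi> y') k')))))"

definition skew_product ::
  "'y digroup \<Rightarrow> 'k digroup \<Rightarrow> ('y \<Rightarrow> 'k \<Rightarrow> 'k) \<Rightarrow> ('y \<Rightarrow> 'k \<Rightarrow> 'k) \<Rightarrow> ('y \<Rightarrow> 'k \<Rightarrow> 'k)
     \<Rightarrow> ('y \<times> 'k) digroup" where
  "skew_product Y K \<psi>\<^sub>s \<psi>\<^sub>c \<xi> =
     \<lparr>carrier = carrier Y \<times> carrier K,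
      star = mult (semidirect (star_group Y) (star_group K) \<psi>\<^sub>s),
      circ = circ_xi Y K \<psi>\<^sub>c \<xi>,
      dunit = (dunit Y, dunit K)\<rparr>"

text \<open>The law \<open>circ_xi\<close> is the semidirect product law transferred along
  \<open>(y, k) \<mapsto> (y, \<xi>\<^sub>y(k))\<close>.\<close>

lemma circ_xi_transfer:
  assumes Y: "is_digroup Y" and K: "is_digroup K"
    and \<psi>: "\<psi> \<in> hom (circ_group Y) (AutoGroup (circ_group K))"
    and \<xi>: "\<xi> \<in> carrier Y \<rightarrow> pointed_perms K"
  shows "(\<lambda>(y, k). (y, \<xi> y k)) \<in>
    iso (semidirect (circ_group Y) (circ_group K) \<psi>) (circ_group (skew_product Y K \<psi>\<^sub>s \<psi> \<xi>))"
proof -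
  have bij: "bij_betw (\<xi> y) (carrier K) (carrier K)" if "y \<in> carrier Y" for y
    using \<xi> that by (auto simp: pointed_perms_def Bij_def)
  have into: "\<xi> y k \<in> carrier K" if "y \<in> carrier Y" "k \<in> carrier K" for y k
    using bij[OF that(1)] that(2) by (meson bij_betwE)
  have inv1: "inv_into (carrier K) (\<xi> y) (\<xi> y k) = k" if "y \<in> carrier Y" "k \<in> carrier K" for y k
    using bij_betw_inv_into_left[OF bij[OF that(1)] that(2)] .
  have cl: "circ Y y y' \<in> carrier Y" if "y \<in> carrier Y" "y' \<in> carrier Y" for y y'
    using monoid.m_closed[of "circ_group Y" y y'] Y that
    by (simp add: is_digroup_def circ_group_def group_def)
  have clK: "circ K k k' \<in> carrier K" if "k \<in> carrier K" "k' \<in> carrier K" for k k'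
    using monoid.m_closed[of "circ_group K" k k'] K that
    by (simp add: is_digroup_def circ_group_def group_def)
  have \<psi>cl: "\<psi> y k \<in> carrier K" if "y \<in> carrier Y" "k \<in> carrier K" for y k
    using \<psi> that by (auto simp: hom_def AutoGroup_def auto_def circ_group_def)
  have "bij_betw (\<lambda>(y, k). (y, \<xi> y k)) (carrier Y \<times> carrier K) (carrier Y \<times> carrier K)"
  proof (rule bij_betw_byWitness[where f' = "\<lambda>(y, k). (y, inv_into (carrier K) (\<xi> y) k)"])
    show "(\<lambda>(y, k). (y, inv_into (carrier K) (\<xi> y) k)) ` (carrier Y \<times> carrier K)
            \<subseteq> carrier Y \<times> carrier K"
      using bij by (auto dest!: bij_betw_inv_into[THEN bij_betwE, rotated] intro: bij_betwE[OF bij_betw_inv_into, rule_format])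
  qed (auto simp: inv1 into bij_betw_inv_into_right[OF bij])
  then show ?thesis
    by (auto simp: iso_def hom_def semidirect_def circ_group_def skew_product_def circ_xi_def
        inv1 into cl clK \<psi>cl)
qed

lemma skewing_index_pointed:
  assumes "split_epi X Y f s"
  shows "skewing_index X Y f s \<in> carrier Y \<rightarrow> pointed_perms (digroup_kernel X Y f)"
    and "skewing_index X Y f s (dunit Y) = (\<lambda>k\<in>carrier (digroup_kernel X Y f). k)"
proof -
  let ?N = "carrier (digroup_kernel X Y f)"
  interpret S: group "star_group X" using assms by (simp add: split_epi_def is_digroup_def)
  interpret C: group "circ_group X" using assms by (simp add: split_epi_def is_digroup_def)
  interpret SY: group "star_group Y" using assms by (simp add: split_epi_def is_digroup_def)
  interpret CY: group "circ_group Y" using assms by (simp add: split_epi_def is_digroup_def)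
  have fS: "f \<in> hom (star_group X) (star_group Y)" and fC: "f \<in> hom (circ_group X) (circ_group Y)"
    and sS: "s \<in> hom (star_group Y) (star_group X)"
    and fs: "\<And>y. y \<in> carrier Y \<Longrightarrow> f (s y) = y"
    using assms by (auto simp: split_epi_def digroup_hom_def)
  interpret fS: group_hom "star_group X" "star_group Y" f by unfold_locales (rule fS)
  interpret fC: group_hom "circ_group X" "circ_group Y" f by unfold_locales (rule fC)
  interpret sS: group_hom "star_group Y" "star_group X" s by unfold_locales (rule sS)
  have [simp]: "carrier (star_group Z) = carrier Z" "carrier (circ_group Z) = carrier Z"
    "mult (star_group Z) = star Z" "mult (circ_group Z) = circ Z"
    "one (star_group Z) = dunit Z" "one (circ_group Z) = dunit Z" for Z :: "'z digroup"
    by (simp_all add: star_group_def circ_group_def)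
  have N: "?N = {x \<in> carrier X. f x = dunit Y}"
    by (simp add: digroup_kernel_def kernel_def)
  have scl: "y \<in> carrier Y \<Longrightarrow> s y \<in> carrier X" for y
    using sS.hom_closed[of y] by simp
  note grp = S.m_closed[simplified] S.inv_closed[simplified] S.m_assoc[simplified]
    S.l_inv[simplified] S.r_inv[simplified] S.l_one[simplified] S.r_one[simplified]
    C.m_closed[simplified] C.inv_closed[simplified] C.m_assoc[simplified]
    C.l_inv[simplified] C.r_inv[simplified] C.l_one[simplified] C.r_one[simplified]
    SY.r_inv[simplified] CY.r_inv[simplified] SY.l_one[simplified] CY.l_one[simplified]
    SY.m_closed[simplified] CY.m_closed[simplified]
  note homs = fS.hom_mult[simplified] fC.hom_mult[simplified] fS.hom_inv[simplified]
    fC.hom_inv[simplified]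
  have one: "dunit X \<in> ?N" using N fS.hom_one S.one_closed by simp
  have bij: "bij_betw (skewing_index X Y f s y) ?N ?N" if y: "y \<in> carrier Y" for y
  proof (rule bij_betw_byWitness[where f' = "\<lambda>k. circ X (star X k (s y)) (inv\<^bsub>circ_group X\<^esub> (s y))"])
    show 1: "skewing_index X Y f s y ` ?N \<subseteq> ?N"
      using y by (auto simp: skewing_index_def N scl fs grp homs)
    show 2: "(\<lambda>k. circ X (star X k (s y)) (inv\<^bsub>circ_group X\<^esub> (s y))) ` ?N \<subseteq> ?N"
      using y by (auto simp: N scl fs grp homs)
    show "\<forall>k\<in>?N. circ X (star X (skewing_index X Y f s y k) (s y)) (inv\<^bsub>circ_group X\<^esub> (s y)) = k"
      using y by (auto simp: skewing_index_def N scl fs grp homs)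
    show "\<forall>k\<in>?N. skewing_index X Y f s y (circ X (star X k (s y)) (inv\<^bsub>circ_group X\<^esub> (s y))) = k"
      using y 2 by (auto simp: skewing_index_def N scl fs grp homs)
  qed
  have pt: "skewing_index X Y f s y (dunit X) = dunit X" if "y \<in> carrier Y" for y
    using that one by (simp add: skewing_index_def scl grp)
  have "dunit (digroup_kernel X Y f) = dunit X" by (simp add: digroup_kernel_def)
  then show "skewing_index X Y f s \<in> carrier Y \<rightarrow> pointed_perms (digroup_kernel X Y f)"
    using bij pt by (auto simp: pointed_perms_def Bij_def skewing_index_def)
  have "s (dunit Y) = dunit X" using sS.hom_one by simp
  then show "skewing_index X Y f s (dunit Y) = (\<lambda>k\<in>?N. k)"
    using S.inv_one by (auto simp: skewing_index_def N grp intro!: restrict_ext)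
qed

end

theory Submission
  imports Defs
begin

text \<open>The star law is a semidirect product, and the circle law is a semidirect product
  transported along (y, k) \<mapsto> (y, \<xi>_y(k)), so both are group laws
  (\<open>group_semidirect\<close>, \<open>circ_xi_transfer\<close>). The permutation fixes (1, 1)
  because \<xi>_1(1) = 1, hence the two laws share their unit
  (\<open>is_digroup_skew_product\<close>). Two properties of \<xi> then yield the remaining claims.
  Since \<xi>_y(1) = 1 for every y, the elements (y, 1) multiply as in Y for both laws, so the
  section is a morphism. Since \<xi>_1 = Id, both laws restrict on {1} \<times> K to those of K. The
  skewing index and the two conjugations become short computations with pairs, in which \<xi>_y
  survives in the former and cancels in the circle conjugation.\<close>

lemma action_facts:
  assumes "group G" and "group H" and \<psi>: "\<psi> \<in> hom G (AutoGroup H)"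
  shows action_hom: "y \<in> carrier G \<Longrightarrow> \<psi> y \<in> hom H H"
    and action_mult: "\<lbrakk>y \<in> carrier G; y' \<in> carrier G; k \<in> carrier H\<rbrakk>
      \<Longrightarrow> \<psi> (y \<otimes>\<^bsub>G\<^esub> y') k = \<psi> y (\<psi> y' k)"
    and action_one: "k \<in> carrier H \<Longrightarrow> \<psi> \<one>\<^bsub>G\<^esub> k = k"
proof -
  show "\<psi> y \<in> hom H H" if "y \<in> carrier G"
    using \<psi> that by (auto simp: hom_def AutoGroup_def auto_def)
  \<comment> \<open>The product of \<open>BijGroup\<close> is restricted to \<open>Bij\<close> in
    both arguments, so it unfolds to \<open>compose\<close> only once membership is known.\<close>
  have Bij: "\<psi> y \<in> Bij (carrier H)" if "y \<in> carrier G" for y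
    using \<psi> that by (auto simp: hom_def AutoGroup_def auto_def)
  show "\<psi> (y \<otimes>\<^bsub>G\<^esub> y') k = \<psi> y (\<psi> y' k)"
    if "y \<in> carrier G" "y' \<in> carrier G" "k \<in> carrier H"
    using hom_mult[OF \<psi> that(1,2)] Bij that
    by (simp add: AutoGroup_def BijGroup_def compose_def)
  show "\<psi> \<one>\<^bsub>G\<^esub> k = k" if "k \<in> carrier H"
    using hom_one[OF \<psi> assms(1) group.AutoGroup[OF assms(2)]] that
    by (simp add: AutoGroup_def BijGroup_def)
qed

lemma group_semidirect:
  assumes G: "group G" and H: "group H" and \<psi>: "\<psi> \<in> hom G (AutoGroup H)"
  shows "group (semidirect G H \<psi>)"
proof -
  interpret G: group G by (rule G)
  interpret H: group H by (rule H)
  have cl: "\<psi> y k \<in> carrier H" if "y \<in> carrier G" "k \<in> carrier H" for y k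
    using hom_in_carrier[OF action_hom[OF G H \<psi> that(1)] that(2)] .
  note act = action_mult[OF G H \<psi>] action_one[OF G H \<psi>] hom_mult[OF action_hom[OF G H \<psi>]] cl
  show ?thesis
  proof (rule groupI)
    fix x assume "x \<in> carrier (semidirect G H \<psi>)"
    then obtain y k where x: "x = (y, k)" "y \<in> carrier G" "k \<in> carrier H"
      by (auto simp: semidirect_def)
    \<comment> \<open>Solve (y^-1, m)(y, k) = (1, m \<psi>_{y^-1}(k)) = (1, 1) for m;
      \<open>groupI\<close> asks for a left inverse only.\<close>
    show "\<exists>z\<in>carrier (semidirect G H \<psi>). z \<otimes>\<^bsub>semidirect G H \<psi>\<^esub> x = \<one>\<^bsub>semidirect G H \<psi>\<^esub>"
      using x by (intro bexI[of _ "(inv\<^bsub>G\<^esub> y, inv\<^bsub>H\<^esub> (\<psi> (inv\<^bsub>G\<^esub> y) k))"])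
        (auto simp: semidirect_def cl)
  qed (auto simp: semidirect_def act G.m_assoc H.m_assoc)
qed

lemma digroup_group_simps [simp]:
  "carrier (star_group X) = carrier X" "carrier (circ_group X) = carrier X"
  "mult (star_group X) = star X" "mult (circ_group X) = circ X"
  "one (star_group X) = dunit X" "one (circ_group X) = dunit X"
  by (simp_all add: star_group_def circ_group_def)

lemma is_digroup_skew_product:
  assumes Y: "is_digroup Y" and K: "is_digroup K"
    and \<psi>s: "\<psi>\<^sub>s \<in> hom (star_group Y) (AutoGroup (star_group K))"
    and \<psi>c: "\<psi>\<^sub>c \<in> hom (circ_group Y) (AutoGroup (circ_group K))"
    and \<xi>: "\<xi> \<in> carrier Y \<rightarrow> pointed_perms K"
    and \<xi>1: "\<xi> (dunit Y) = (\<lambda>k\<in>carrier K. k)"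
  shows "is_digroup (skew_product Y K \<psi>\<^sub>s \<psi>\<^sub>c \<xi>)"
proof -
  interpret SK: group "star_group K" using K by (simp add: is_digroup_def)
  let ?E = "skew_product Y K \<psi>\<^sub>s \<psi>\<^sub>c \<xi>"
  let ?S = "semidirect (star_group Y) (star_group K) \<psi>\<^sub>s"
  let ?C = "semidirect (circ_group Y) (circ_group K) \<psi>\<^sub>c"
  have "star_group ?E = ?S"
    by (simp add: star_group_def skew_product_def semidirect_def)
  then have S: "group (star_group ?E)"
    using group_semidirect[OF _ _ \<psi>s] Y K by (simp add: is_digroup_def)
  have C: "group ?C"
    using group_semidirect[OF _ _ \<psi>c] Y K by (simp add: is_digroup_def)
  \<comment> \<open>Transport along a bijection yields a group whose unit is the image of the old
    one. That image is (1, \<xi>_1(1)) = (1, 1), so the record update changes nothing.\<close>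
  have "circ_group ?E\<lparr>one := (\<lambda>(y, k). (y, \<xi> y k)) \<one>\<^bsub>?C\<^esub>\<rparr> = circ_group ?E"
    using \<xi>1 SK.one_closed by (simp add: semidirect_def circ_group_def skew_product_def)
  then have "group (circ_group ?E)"
    using group.iso_imp_img_group[OF C circ_xi_transfer[OF Y K \<psi>c \<xi>, of \<psi>\<^sub>s]] by simp
  with S show ?thesis by (simp add: is_digroup_def)
qed

theorem proposition2p1:
  fixes Y :: "'y digroup" and K :: "'k digroup"
    and \<psi>\<^sub>s \<psi>\<^sub>c \<xi> :: "'y \<Rightarrow> 'k \<Rightarrow> 'k"
  assumes "is_digroup Y" and "is_digroup K"
    and "\<psi>\<^sub>s \<in> hom (star_group Y) (AutoGroup (star_group K))"
    and "\<psi>\<^sub>c \<in> hom (circ_group Y) (AutoGroup (circ_group K))"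
    and "\<xi> \<in> carrier Y \<rightarrow> pointed_perms K"
    and "\<xi> (dunit Y) = (\<lambda>k\<in>carrier K. k)"
  defines "E \<equiv> skew_product Y K \<psi>\<^sub>s \<psi>\<^sub>c \<xi>"
    and "p \<equiv> (fst :: 'y \<times> 'k \<Rightarrow> 'y)"
    and "\<iota> \<equiv> (\<lambda>y::'y. (y, dunit K))"
    and "\<kappa> \<equiv> (\<lambda>k::'k. (dunit Y, k))"
  shows "split_epi E Y p \<iota>
    \<and> \<kappa> \<in> digroup_iso K (digroup_kernel E Y p)
    \<and> (\<forall>y\<in>carrier Y. \<forall>k\<in>carrier K.
          skewing_index E Y p \<iota> y (\<kappa> k) = \<kappa> (\<xi> y k))
    \<and> (\<forall>y\<in>carrier Y. \<forall>k\<in>carrier K.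
          canonical_action (star_group E) (carrier (digroup_kernel E Y p)) \<iota> y (\<kappa> k) = \<kappa> (\<psi>\<^sub>s y k))
    \<and> (\<forall>y\<in>carrier Y. \<forall>k\<in>carrier K.
          canonical_action (circ_group E) (carrier (digroup_kernel E Y p)) \<iota> y (\<kappa> k) = \<kappa> (\<psi>\<^sub>c y k))"
proof -
  note Y = assms(1) and K = assms(2) and \<psi>s = assms(3) and \<psi>c = assms(4)
    and \<xi> = assms(5) and \<xi>1 = assms(6)
  have grp: "group (star_group Y)" "group (circ_group Y)"
      "group (star_group K)" "group (circ_group K)"
    using Y K by (simp_all add: is_digroup_def)
  interpret SY: group "star_group Y" by (rule grp)
  interpret CY: group "circ_group Y" by (rule grp)
  interpret SK: group "star_group K" by (rule grp)
  interpret CK: group "circ_group K" by (rule grp)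
  have E: "is_digroup E"
    unfolding E_def using is_digroup_skew_product[OF Y K \<psi>s \<psi>c \<xi> \<xi>1] .
  interpret SE: group "star_group E" using E by (simp add: is_digroup_def)
  interpret CE: group "circ_group E" using E by (simp add: is_digroup_def)
  note grps = SY.m_closed[simplified] SY.l_one[simplified] SY.r_one[simplified]
    SY.inv_closed[simplified] SY.r_inv[simplified] SY.one_closed[simplified]
    CY.m_closed[simplified] CY.l_one[simplified] CY.r_one[simplified]
    CY.inv_closed[simplified] CY.r_inv[simplified]
    SK.m_closed[simplified] SK.l_one[simplified] SK.r_one[simplified] SK.one_closed[simplified]
    CK.m_closed[simplified] CK.l_one[simplified] CK.r_one[simplified]
  have bij: "bij_betw (\<xi> y) (carrier K) (carrier K)"
    and \<xi>_unit: "\<xi> y (dunit K) = dunit K" if "y \<in> carrier Y" for y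
    using \<xi> that by (auto simp: pointed_perms_def Bij_def)
  have \<xi>_in: "\<xi> y k \<in> carrier K" if "y \<in> carrier Y" "k \<in> carrier K" for y k
    using bij[OF that(1)] that(2) by (meson bij_betwE)
  have inv_unit: "inv_into (carrier K) (\<xi> y) (dunit K) = dunit K" if "y \<in> carrier Y" for y
    using bij_betw_inv_into_left[OF bij[OF that] SK.one_closed[simplified]] \<xi>_unit[OF that] by simp
  have inv_\<xi>: "inv_into (carrier K) (\<xi> y) (\<xi> y k) = k" if "y \<in> carrier Y" "k \<in> carrier K" for y k
    using bij_betw_inv_into_left[OF bij[OF that(1)] that(2)] .
  \<comment> \<open>Needed besides \<open>inv_\<xi>\<close>: once \<open>\<xi>1\<close> has
    rewritten \<open>\<xi> (dunit Y)\<close>, its inverse appears in this form.\<close>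
  have inv_1: "inv_into (carrier K) (\<lambda>k\<in>carrier K. k) k = k" if "k \<in> carrier K" for k
    using inv_\<xi>[of "dunit Y" k] \<xi>1 SY.one_closed that by simp
  note acts = action_one[OF grp(1,3) \<psi>s, simplified] action_one[OF grp(2,4) \<psi>c, simplified]
    hom_in_carrier[OF action_hom[OF grp(1,3) \<psi>s], simplified]
    hom_in_carrier[OF action_hom[OF grp(2,4) \<psi>c], simplified]
    hom_one[OF action_hom[OF grp(1,3) \<psi>s] grp(3,3), simplified]
    hom_one[OF action_hom[OF grp(2,4) \<psi>c] grp(4,4), simplified]
  have E_simps [simp]: "carrier E = carrier Y \<times> carrier K" "dunit E = (dunit Y, dunit K)"
    "star E (y, k) (y', k') = (star Y y y', star K k (\<psi>\<^sub>s y k'))"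
    "circ E (y, k) (y', k') = circ_xi Y K \<psi>\<^sub>c \<xi> (y, k) (y', k')" for y k y' k'
    by (simp_all add: E_def skew_product_def semidirect_def)
  note simps = grps acts \<xi>1 \<xi>_unit \<xi>_in inv_unit inv_\<xi> inv_1 circ_xi_def

  have p: "p \<in> digroup_hom E Y"
    using SE.m_closed CE.m_closed by (auto simp: digroup_hom_def hom_def p_def simps)
  \<comment> \<open>For the circle law, the second component is \<xi>_{y \<circ> y'}(1 \<circ>
    \<psi>_y(1)) = 1, as all permutations and automorphisms involved fix 1.\<close>
  have \<iota>: "\<iota> \<in> digroup_hom Y E"
    by (auto simp: digroup_hom_def hom_def \<iota>_def simps)
  have split: "split_epi E Y p \<iota>"
    using Y E p \<iota> by (simp add: split_epi_def p_def \<iota>_def)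
  have ker: "carrier (digroup_kernel E Y p) = {dunit Y} \<times> carrier K"
    by (auto simp: digroup_kernel_def kernel_def p_def simps)
  have ker_laws: "star (digroup_kernel E Y p) = star E" "circ (digroup_kernel E Y p) = circ E"
    by (simp_all add: digroup_kernel_def)
  \<comment> \<open>Over y = y' = 1 every \<xi> and every \<psi> in the two laws is the
    identity.\<close>
  have "\<kappa> \<in> digroup_hom K (digroup_kernel E Y p)"
    by (auto simp: digroup_hom_def hom_def ker ker_laws \<kappa>_def simps)
  moreover have "bij_betw \<kappa> (carrier K) (carrier (digroup_kernel E Y p))"
    by (auto simp: bij_betw_def inj_on_def \<kappa>_def ker)
  ultimately have iso: "\<kappa> \<in> digroup_iso K (digroup_kernel E Y p)"
    by (simp add: digroup_iso_def)
  interpret S\<iota>: group_hom "star_group Y" "star_group E" \<iota>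
    using \<iota> by unfold_locales (simp add: digroup_hom_def)
  interpret C\<iota>: group_hom "circ_group Y" "circ_group E" \<iota>
    using \<iota> by unfold_locales (simp add: digroup_hom_def)
  \<comment> \<open>Inverses of (y, 1) come from \<iota> being a morphism, which avoids inverting a
    general pair for the transported law.\<close>
  have inv_S: "inv\<^bsub>star_group E\<^esub> (y, dunit K) = (inv\<^bsub>star_group Y\<^esub> y, dunit K)"
    and inv_C: "inv\<^bsub>circ_group E\<^esub> (y, dunit K) = (inv\<^bsub>circ_group Y\<^esub> y, dunit K)"
    if "y \<in> carrier Y" for y
    using S\<iota>.hom_inv[of y] C\<iota>.hom_inv[of y] that by (simp_all add: \<iota>_def)
  \<comment> \<open>Skewing index: (1, k) \<circ> (y, 1) = (y, \<xi>_y(k)), and star multiplication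
    by (y^-1, 1) only resets y to 1. Circle conjugation: (y, 1) \<circ> (1, k) = (y,
    \<xi>_y(\<psi>_y(k))), and multiplying by (y^-1, 1) applies \<xi>_y^-1 and then \<xi>_1 = Id,
    leaving \<psi>_y(k).\<close>
  show ?thesis
    using split iso
    by (simp add: skewing_index_def canonical_action_def ker \<iota>_def \<kappa>_def inv_S inv_C simps)
qed

end
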